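(* Suppose $T \in \mathrm{PTab}_n$ and $\mathrm{RSK}(T) = (PT,T_{\max})$. Let $\alpha_{ij}$ be the number of $i$'s appearing in row $j$ of the ptableau $PT$, and let \[ \beta_{st} = \alpha_{1,t} + \cdots + \alpha_{s,t},\] \[ e_{(\ell)} = e_{n-\ell}^{\beta_{n-\ell,n}} \cdots e_{1}^{\beta_{1,(1+\ell)}},\] and finally \[ e_{( * )} = e_{(n-1)} e_{(n-2)} \cdots e_{(1)}. \] Then \[ T_{\max} = e_{( * )}T. \]
   Context: $\mathrm{PTab}_n$ is the set of perforated tableaux (ptableaux) with $n$ rows: rectangular arrays of blanks and cells containing positive integers such that for each $i$ the $i$'s form a horizontal strip, for $i<j$ no $j$ lies in a higher row or in a column left of a column containing an $i$, and the number of columns is minimal, up to row-equivalence. For $1\le i<n$ the crystal operator $e_i$ moves up into row $i$ the cell of row $i+1$ corresponding to the right-most cell with a blank above it in the left-justified form of rows $i,i+1$. $\mathrm{RSK}(T)=(PT,T_{\max})$ is the ptableau RSK insertion algorithm, which produces $PT$ plactically equivalent to $T$ and lying in the distinguished crystal (the irreducible crystal whose highest weight has only $i$'s in row $i$; equivalently $PT$ satisfies the word condition), and $T_{\max}$ the highest weight element of the irreducible crystal containing $T$. *)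

theory Defs
  imports Main
begin

text \<open>Perforated tableaux. An array maps a row and a column (both counted from 1) to an entry,
  or to \<open>None\<close> for a blank.\<close>

type_synonym ptarray = "nat \<Rightarrow> nat \<Rightarrow> nat option"

definition num :: "ptarray \<Rightarrow> nat \<Rightarrow> nat \<Rightarrow> nat" where
  "num A x r = card {c. A r c = Some x}"

definition row_equiv :: "ptarray \<Rightarrow> ptarray \<Rightarrow> bool" where
  "row_equiv A B \<longleftrightarrow> (\<forall>x r. num A x r = num B x r)"

text \<open>In the definition of \<open>pt_filling\<close>, the second conjunct says that for \<open>y < x\<close> no \<open>x\<close> lies
  weakly above and weakly left of a \<open>y\<close>; so rows weakly increase, and columns increase
  downwards, blanks being ignored. The third conjunct is the horizontal strip condition: among
  equal entries, those in lower rows lie in columns strictly further left.\<close>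

definition pt_filling :: "nat \<Rightarrow> nat \<Rightarrow> ptarray \<Rightarrow> bool" where
  "pt_filling n m A \<longleftrightarrow>
     (\<forall>r c x. A r c = Some x \<longrightarrow> r \<in> {1..n} \<and> c \<in> {1..m} \<and> 1 \<le> x) \<and>
     (\<forall>r c r' c' x y. A r c = Some x \<and> A r' c' = Some y \<and> r \<le> r' \<and> c \<le> c' \<longrightarrow> x \<le> y) \<and>
     (\<forall>r c r' c' x. A r c = Some x \<and> A r' c' = Some x \<and> r < r' \<longrightarrow> c' < c)"

definition ptableau :: "nat \<Rightarrow> ptarray \<Rightarrow> bool" where
  "ptableau n A \<longleftrightarrow>
     (\<exists>m. pt_filling n m A \<and> (\<forall>m' B. pt_filling n m' B \<and> row_equiv A B \<longrightarrow> m \<le> m'))"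

type_synonym ptab = "ptarray set"

definition PTab :: "nat \<Rightarrow> ptab set" where
  "PTab n = {A. ptableau n A} // {(A, B). ptableau n A \<and> ptableau n B \<and> row_equiv A B}"

definition rep :: "ptab \<Rightarrow> ptarray" where
  "rep P = (SOME A. A \<in> P)"

definition entries :: "ptab \<Rightarrow> nat \<Rightarrow> nat \<Rightarrow> nat" where
  "entries P x r = num (rep P) x r"

definition wt :: "ptab \<Rightarrow> nat \<Rightarrow> nat" where
  "wt P r = card {c. rep P r c \<noteq> None}"


text \<open>\<open>L\<close> is the left-justified form of rows \<open>i\<close> and \<open>i + 1\<close> of \<open>A\<close>: among all fillings consisting
  of these two rows only, every cell is as far left as possible. (Equivalently, each initial
  segment of columns contains as many cells of each of the rows as possible. Such a form exists and
  is unique, and in particular it has the minimal number of columns.)\<close>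

definition two_rows :: "nat \<Rightarrow> ptarray \<Rightarrow> ptarray \<Rightarrow> bool" where
  "two_rows i A L \<longleftrightarrow>
     (\<exists>m. pt_filling (i + 1) m L) \<and>
     (\<forall>x r. num L x r = (if r = i \<or> r = i + 1 then num A x r else 0))"

definition left_justified :: "nat \<Rightarrow> ptarray \<Rightarrow> ptarray \<Rightarrow> bool" where
  "left_justified i A L \<longleftrightarrow> two_rows i A L \<and>
     (\<forall>L'. two_rows i A L' \<longrightarrow>
        (\<forall>r c. card {d. d \<le> c \<and> L' r d \<noteq> None} \<le> card {d. d \<le> c \<and> L r d \<noteq> None}))"

text \<open>The crystal operators; \<open>None\<close> plays the role of the null element. The result is the
  row-equivalence class of the ptableaux obtained by moving one entry \<open>x\<close> from row \<open>i + 1\<close> to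
  row \<open>i\<close>.\<close>

definition cr_e :: "nat \<Rightarrow> nat \<Rightarrow> ptab \<Rightarrow> ptab option" where
  "cr_e n i P =
     (let A = rep P;
          L = (THE L. left_justified i A L);
          C = {c. L (i + 1) c \<noteq> None \<and> L i c = None}
      in if C = {} then None
         else let x = the (L (i + 1) (Max C))
              in Some {B. ptableau n B \<and>
                   num B = (num A)(x := (num A x)(i := num A x i + 1,
                                                   i + 1 := num A x (i + 1) - 1))})"

text \<open>The irreducible crystal containing \<open>P\<close> is its connected component in the crystal graph. As
  \<open>f\<^sub>i\<close> is the partial inverse of \<open>e\<^sub>i\<close>, following the edges in both directions accounts for
  both families of operators; likewise a bijection of components that commutes with all \<open>e\<^sub>i\<close>
  commutes with all \<open>f\<^sub>i\<close>.\<close>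

definition cr_edges :: "nat \<Rightarrow> (ptab \<times> ptab) set" where
  "cr_edges n = {(P, Q). P \<in> PTab n \<and> Q \<in> PTab n \<and> (\<exists>i\<in>{1..<n}. cr_e n i P = Some Q)}"

definition irr_crystal :: "nat \<Rightarrow> ptab \<Rightarrow> ptab set" where
  "irr_crystal n P = {Q. (P, Q) \<in> (cr_edges n \<union> (cr_edges n)\<inverse>)\<^sup>*}"

definition highest_weight :: "nat \<Rightarrow> ptab \<Rightarrow> bool" where
  "highest_weight n P \<longleftrightarrow> (\<forall>i\<in>{1..<n}. cr_e n i P = None)"

definition crystal_iso :: "nat \<Rightarrow> ptab set \<Rightarrow> ptab set \<Rightarrow> (ptab \<Rightarrow> ptab) \<Rightarrow> bool" where
  "crystal_iso n X Y \<phi> \<longleftrightarrow> bij_betw \<phi> X Y \<and>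
     (\<forall>P\<in>X. (\<forall>r\<in>{1..n}. wt (\<phi> P) r = wt P r) \<and>
             (\<forall>i\<in>{1..<n}. cr_e n i (\<phi> P) = map_option \<phi> (cr_e n i P)))"

definition plactic_equiv :: "nat \<Rightarrow> ptab \<Rightarrow> ptab \<Rightarrow> bool" where
  "plactic_equiv n P Q \<longleftrightarrow>
     (\<exists>\<phi>. crystal_iso n (irr_crystal n P) (irr_crystal n Q) \<phi> \<and> \<phi> P = Q)"

definition in_distinguished :: "nat \<Rightarrow> ptab \<Rightarrow> bool" where
  "in_distinguished n P \<longleftrightarrow>
     (\<exists>H\<in>irr_crystal n P. highest_weight n H \<and> (\<forall>x r. entries H x r \<noteq> 0 \<longrightarrow> x = r))"

text \<open>The output of the RSK insertion, given by its specification, which determines the pair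
  uniquely: a plactic class contains one element of a distinguished crystal, and an irreducible
  crystal contains one element of highest weight.\<close>

definition RSK :: "nat \<Rightarrow> ptab \<Rightarrow> ptab \<times> ptab \<Rightarrow> bool" where
  "RSK n T = (\<lambda>(PT, Tmax).
     PT \<in> PTab n \<and> plactic_equiv n T PT \<and> in_distinguished n PT \<and>
     Tmax \<in> irr_crystal n T \<and> highest_weight n Tmax)"


definition e_op :: "nat \<Rightarrow> nat \<Rightarrow> ptab option \<Rightarrow> ptab option" where
  "e_op n i P = Option.bind P (cr_e n i)"

definition \<beta> :: "(nat \<Rightarrow> nat \<Rightarrow> nat) \<Rightarrow> nat \<Rightarrow> nat \<Rightarrow> nat" where
  "\<beta> \<alpha> s t = (\<Sum>i=1..s. \<alpha> i t)"

text \<open>\<open>fold\<close> applies the operator with the smallest index first, i.e. it stands rightmost in the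
  product.\<close>

definition e_level :: "nat \<Rightarrow> (nat \<Rightarrow> nat \<Rightarrow> nat) \<Rightarrow> nat \<Rightarrow> ptab option \<Rightarrow> ptab option" where
  "e_level n \<alpha> l = fold (\<lambda>k. e_op n k ^^ \<beta> \<alpha> k (k + l)) [1..<n - l + 1]"

definition e_star :: "nat \<Rightarrow> (nat \<Rightarrow> nat \<Rightarrow> nat) \<Rightarrow> ptab option \<Rightarrow> ptab option" where
  "e_star n \<alpha> = fold (e_level n \<alpha>) [1..<n]"

end

theory Submission
  imports Defs
begin

text \<open>A class of ptableaux is the same thing as its matrix of entry counts (rows \<open>1..n\<close>, entries
  \<open>\<ge> 1\<close>), and \<open>e\<^sub>i\<close> is computed on matrices: with \<open>a\<close> and \<open>b\<close> the contents of rows \<open>i\<close> and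
  \<open>i + 1\<close>, it moves up the least entry \<open>x\<close> maximising \<open>\<Sum>\<^bsub>y\<le>x\<^esub> b y - \<Sum>\<^bsub>y<x\<^esub> a y\<close>, provided this
  maximum is positive. The word condition and the number of occurrences of each entry are constant
  on irreducible crystals. A highest weight element satisfying the word condition is diagonal, that
  is, it has only \<open>i\<close>'s in row \<open>i\<close>; so the distinguished crystal has a unique highest weight
  element. On \<open>PT\<close>, level \<open>l\<close> of \<open>e_star\<close> shifts up by one row every entry that is
  not yet on the diagonal, so \<open>e_star\<close> ends at this element. The crystal isomorphism between
  the components of \<open>T\<close> and \<open>PT\<close> transports this back to \<open>T\<close>.\<close>

section \<open>Greedy rows and left-justified forms\<close>

text \<open>These prefix counts are what \<open>left_justified\<close> compares; together with the
  content they determine a row.\<close>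

definition occ :: "(nat \<Rightarrow> nat option) \<Rightarrow> nat \<Rightarrow> nat" where
  "occ f c = card {d. d \<le> c \<and> f d \<noteq> None}"

definition row_of :: "(nat \<Rightarrow> nat) \<Rightarrow> (nat \<Rightarrow> nat option) \<Rightarrow> bool" where
  "row_of a f \<longleftrightarrow> f 0 = None \<and> finite {c. f c \<noteq> None} \<and>
     (\<forall>c d x y. f c = Some x \<and> f d = Some y \<and> c \<le> d \<longrightarrow> x \<le> y) \<and>
     (\<forall>x. card {c. f c = Some x} = a x)"

lemma occ_0: "f 0 = None \<Longrightarrow> occ f 0 = 0"
  by (auto simp: occ_def intro!: Nat.gr0I)

lemma occ_Suc: "occ f (Suc c) = occ f c + (if f (Suc c) = None then 0 else 1)"
proof -
  have "{d. d \<le> Suc c \<and> f d \<noteq> None} =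
      (if f (Suc c) = None then {d. d \<le> c \<and> f d \<noteq> None}
       else insert (Suc c) {d. d \<le> c \<and> f d \<noteq> None})"
    using le_Suc_eq by auto
  then show ?thesis by (simp add: occ_def)
qed

lemma row_of_card:
  assumes "row_of a f" "finite W"
  shows "card {d. \<exists>w\<in>W. f d = Some w} = sum a W"
proof -
  have fin: "finite {c. f c = Some w}" for w
    using assms(1) by (auto simp: row_of_def intro: rev_finite_subset)
  have "{d. \<exists>w\<in>W. f d = Some w} = (\<Union>w\<in>W. {c. f c = Some w})" by auto
  also have "card \<dots> = (\<Sum>w\<in>W. card {c. f c = Some w})"
    by (rule card_UN_disjoint) (use assms(2) fin in auto)
  finally show ?thesis using assms(1) by (simp add: row_of_def)
qed

lemma row_of_finite: "row_of a f \<Longrightarrow> finite {d. \<exists>w\<in>W. f d = Some w}"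
  by (auto simp: row_of_def elim!: rev_finite_subset)

text \<open>In a weakly increasing row, smaller entries stand further left and everything to the
  left is at most \<open>v\<close>. So the entry in column \<open>Suc c\<close> is the one of rank
  \<open>occ f c\<close>, counted from 0, in the content.\<close>

lemma row_of_value:
  assumes "row_of a f" "f (Suc c) = Some v"
  shows "sum a {..<v} \<le> occ f c" "occ f c < sum a {..v}"
proof -
  have "\<not> Suc c \<le> d" if "f d = Some w" "w < v" for d w
    using that assms by (fastforce simp: row_of_def)
  then have "{d. \<exists>w\<in>{..<v}. f d = Some w} \<subseteq> {d. d \<le> c \<and> f d \<noteq> None}"
    by (auto simp: not_less_eq_eq)
  then have "card {d. \<exists>w\<in>{..<v}. f d = Some w} \<le> occ f c"
    unfolding occ_def by (intro card_mono) auto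
  then show "sum a {..<v} \<le> occ f c" using row_of_card[OF assms(1)] by simp
  have "w \<le> v" if "d \<le> c" "f d = Some w" for d w
    using that assms by (fastforce simp: row_of_def)
  then have sub: "insert (Suc c) {d. d \<le> c \<and> f d \<noteq> None} \<subseteq> {d. \<exists>w\<in>{..v}. f d = Some w}"
    using assms(2) by auto
  have "card (insert (Suc c) {d. d \<le> c \<and> f d \<noteq> None}) \<le> sum a {..v}"
    using card_mono[OF row_of_finite[OF assms(1)] sub] row_of_card[OF assms(1)] by simp
  then show "occ f c < sum a {..v}" by (simp add: occ_def)
qed

lemma sum_le_atMost: "v \<le> w \<Longrightarrow> sum (a :: nat \<Rightarrow> nat) {..v} \<le> sum a {..w}"
  by (intro sum_mono2) auto

lemma sum_le_support:
  fixes a :: "nat \<Rightarrow> nat"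
  assumes "\<And>v. v > X \<Longrightarrow> a v = 0"
  shows "sum a {..v} \<le> sum a {..X}"
proof (cases "v \<le> X")
  case False
  then have "sum a {..v} = sum a {..X}" by (intro sum.mono_neutral_right) (auto simp: assms)
  then show ?thesis by simp
qed (rule sum_le_atMost)

lemma sum_le_lessThan: "v < w \<Longrightarrow> sum (a :: nat \<Rightarrow> nat) {..v} \<le> sum a {..<w}"
  by (intro sum_mono2) auto

lemma row_of_unique:
  assumes "row_of a f" "row_of a g" "\<And>c. occ f c = occ g c"
  shows "f = g"
proof
  fix c
  show "f c = g c"
  proof (cases c)
    case 0
    then show ?thesis using assms by (simp add: row_of_def)
  next
    case (Suc d)
    have "f c = None \<longleftrightarrow> g c = None"
      using assms(3)[of c] assms(3)[of d] Suc by (simp add: occ_Suc split: if_splits)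
    moreover have "v = w" if "f c = Some v" "g c = Some w" for v w
    proof -
      have "\<not> v < w" "\<not> w < v"
        using row_of_value[OF assms(1), of d v] row_of_value[OF assms(2), of d w] that Suc
          assms(3)[of d] sum_le_lessThan[of v w a] sum_le_lessThan[of w v a] by auto
      then show ?thesis by simp
    qed
    ultimately show ?thesis by (metis not_None_eq)
  qed
qed

text \<open>A row with content \<open>a\<close> is filled from the left above a left-packed row with content \<open>b\<close>: a
  cell \<open>v\<close> may go to column \<open>c + 1\<close> once the entries \<open>\<le> v\<close> below it all lie in columns \<open>\<le> c\<close>. Taking
  \<open>b = 0\<close> gives the left-packed row itself.\<close>

fun greedy_count :: "(nat \<Rightarrow> nat) \<Rightarrow> (nat \<Rightarrow> nat) \<Rightarrow> nat \<Rightarrow> nat" where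
  "greedy_count a b 0 = 0"
| "greedy_count a b (Suc c) = greedy_count a b c + (if \<exists>v. greedy_count a b c < sum a {..v} \<and> sum b {..v} \<le> c then 1 else 0)"

fun greedy :: "(nat \<Rightarrow> nat) \<Rightarrow> (nat \<Rightarrow> nat) \<Rightarrow> nat \<Rightarrow> nat option" where
  "greedy a b 0 = None"
| "greedy a b (Suc c) = (if \<exists>v. greedy_count a b c < sum a {..v} \<and> sum b {..v} \<le> c
     then Some (LEAST v. greedy_count a b c < sum a {..v}) else None)"

declare greedy.simps(2) [simp del]

lemma greedy_eq_None:
  "greedy a b (Suc c) = None \<longleftrightarrow> \<not> (\<exists>v. greedy_count a b c < sum a {..v} \<and> sum b {..v} \<le> c)"
  by (simp add: greedy.simps(2))

lemma occ_greedy: "occ (greedy a b) c = greedy_count a b c"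
  by (induction c) (simp_all add: occ_0 occ_Suc greedy_eq_None)

text \<open>The entry placed is the least one still available. Since \<open>sum b {..v}\<close>
  grows with \<open>v\<close>, it meets the constraint imposed by the lower row as soon as some
  available entry does.\<close>

lemma greedy_SomeD:
  assumes "greedy a b (Suc c) = Some v"
  shows "sum a {..<v} \<le> greedy_count a b c" "greedy_count a b c < sum a {..v}" "sum b {..v} \<le> c"
proof -
  obtain w where w: "greedy_count a b c < sum a {..w}" "sum b {..w} \<le> c"
    and v: "v = (LEAST v. greedy_count a b c < sum a {..v})"
    using assms by (auto simp: greedy.simps(2) split: if_splits)
  show lt: "greedy_count a b c < sum a {..v}" unfolding v using w(1) by (rule LeastI)
  have "v \<le> w" unfolding v using w(1) by (rule Least_le)
  then show "sum b {..v} \<le> c" using sum_le_atMost[of v w b] w(2) by simp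
  show "sum a {..<v} \<le> greedy_count a b c"
  proof (cases v)
    case (Suc u)
    have "\<not> greedy_count a b c < sum a {..u}"
      using not_less_Least[of u "\<lambda>v. greedy_count a b c < sum a {..v}"] v Suc by simp
    then show ?thesis using Suc by (simp add: lessThan_Suc_atMost)
  qed simp
qed

lemma greedy_count_mono: "c \<le> d \<Longrightarrow> greedy_count a b c \<le> greedy_count a b d"
  by (rule lift_Suc_mono_le) auto

text \<open>Beyond column \<open>sum b {..X}\<close> nothing obstructs a placement, so every further
  column receives a cell until the content is used up. Each placement raises the count by one, so
  the counts before the placements run through all ranks.\<close>

lemma greedy_bij:
  assumes X: "\<And>v. v > X \<Longrightarrow> a v = 0"
  shows "bij_betw (greedy_count a b) {c. greedy a b (Suc c) \<noteq> None} {..<sum a {..X}}"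
    (is "bij_betw ?n ?S {..<?t}")
proof -
  have le: "sum a {..v} \<le> ?t" for v by (rule sum_le_support) (rule X)
  have grow: "min j ?t \<le> ?n (sum b {..X} + j)" for j
  proof (induction j)
    case (Suc j)
    then show ?case
      by (cases "?n (sum b {..X} + j) < ?t") (auto dest: spec[of _ X])
  qed simp
  have "inj_on ?n ?S"
  proof (rule linorder_inj_onI)
    fix c d assume "c < d" "c \<in> ?S" "d \<in> ?S"
    then have "?n c < ?n (Suc c)" "Suc c \<le> d" using greedy_eq_None[of a b c] by auto
    then show "?n c \<noteq> ?n d" using greedy_count_mono[of "Suc c" d a b] by simp
  qed auto
  moreover have "?n ` ?S \<subseteq> {..<?t}"
    using le[THEN less_le_trans[rotated]] greedy_SomeD(2)[of a b] by blast
  moreover have "k \<in> ?n ` ?S" if k: "k < ?t" for k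
  proof -
    define c where "c = (LEAST c. k < ?n c)"
    have "k < ?n (sum b {..X} + ?t)" using grow[of ?t] k by simp
    then have c: "k < ?n c" unfolding c_def by (rule LeastI)
    then obtain d where d: "c = Suc d" by (cases c) auto
    then have "\<not> k < ?n d" unfolding c_def using not_less_Least lessI by metis
    then have "?n d = k" "d \<in> ?S" using c d by (auto simp del: not_None_eq simp: greedy_eq_None split: if_splits)
    then show ?thesis by blast
  qed
  ultimately show ?thesis unfolding bij_betw_def by blast
qed

lemma greedy_mono:
  assumes "greedy a b c = Some x" "greedy a b d = Some y" "c \<le> d"
  shows "x \<le> y"
proof -
  obtain c' d' where cd: "c = Suc c'" "d = Suc d'" using assms by (cases c; cases d) auto
  show ?thesis
  proof (rule ccontr)
    assume "\<not> x \<le> y"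
    then have "sum a {..y} \<le> sum a {..<x}" by (intro sum_le_lessThan) simp
    then show False using greedy_SomeD[of a b c' x] greedy_SomeD[of a b d' y] assms cd
      greedy_count_mono[of c' d' a b] by simp
  qed
qed

text \<open>Under the bijection with ranks, the cells holding \<open>x\<close> correspond to the
  interval from \<open>sum a {..<x}\<close> up to \<open>sum a {..x}\<close>, which has
  \<open>a x\<close> elements.\<close>

lemma row_of_greedy:
  assumes X: "\<And>v. v > X \<Longrightarrow> a v = 0"
  shows "row_of a (greedy a b)"
proof -
  let ?n = "greedy_count a b" and ?S = "{c. greedy a b (Suc c) \<noteq> None}"
  note bij = greedy_bij[of X a b, OF X]
  have fin: "finite ?S" using bij bij_betw_finite by blast
  have supp: "{c. greedy a b c \<noteq> None} = Suc ` ?S" (is "?A = _")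
  proof (intro equalityI subsetI)
    fix c assume "c \<in> ?A"
    then show "c \<in> Suc ` ?S" by (cases c) auto
  qed auto
  have card: "card {c. greedy a b c = Some x} = a x" for x
  proof -
    let ?P = "{c. greedy a b (Suc c) = Some x}"
    have "{c. greedy a b c = Some x} = Suc ` ?P"
    (is "?A = _")
    proof (intro equalityI subsetI)
      fix c assume "c \<in> ?A"
      then show "c \<in> Suc ` ?P" by (cases c) auto
    qed auto
    then have "card {c. greedy a b c = Some x} = card ?P" by (simp add: card_image)
    also have "\<dots> = card (?n ` ?P)"
      using bij by (intro card_image[symmetric]) (auto simp: bij_betw_def intro: inj_on_subset)
    also have "?n ` ?P = {sum a {..<x}..<sum a {..x}}"
    proof (intro equalityI subsetI)
      fix k assume "k \<in> ?n ` ?P"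
      then show "k \<in> {sum a {..<x}..<sum a {..x}}" using greedy_SomeD(1,2)[of a b _ x] by auto
    next
      fix k assume k: "k \<in> {sum a {..<x}..<sum a {..x}}"
      have "x \<le> X"
      proof (rule ccontr)
        assume "\<not> x \<le> X"
        then have "sum a {..<x} = sum a {..x}"
          by (intro sum.mono_neutral_left) (auto simp: X not_less)
        then show False using k by simp
      qed
      then have "k \<in> {..<sum a {..X}}" using k sum_le_atMost[of x X a] by simp
      then obtain c where c: "k = ?n c" "c \<in> ?S"
        using bij unfolding bij_betw_def by blast
      then obtain v where v: "greedy a b (Suc c) = Some v" by blast
      note D = greedy_SomeD(1,2)[OF v]
      have "\<not> v < x" "\<not> x < v"
        using D k c sum_le_lessThan[of v x a] sum_le_lessThan[of x v a] by auto
      then show "k \<in> ?n ` ?P" using v c by auto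
    qed
    also have "card {sum a {..<x}..<sum a {..x}} = a x"
      by (simp add: lessThan_Suc_atMost[symmetric])
    finally show ?thesis .
  qed
  show ?thesis
    unfolding row_of_def
  proof (intro conjI allI impI)
    show "finite {c. greedy a b c \<noteq> None}" using fin supp by simp
  qed (use card greedy_mono in auto)
qed

text \<open>Greedy placement stays ahead of any admissible row: if both counts agree and
  \<open>f\<close> has a cell in the next column, its value witnesses that the greedy row has one
  there too; if \<open>f\<close> is behind, one cell can at most make the counts equal.\<close>

lemma occ_le_greedy_count:
  assumes "row_of a f" and "\<And>c v. f (Suc c) = Some v \<Longrightarrow> sum b {..v} \<le> c"
  shows "occ f c \<le> greedy_count a b c"
proof (induction c)
  case 0
  then show ?case using assms(1) by (simp add: occ_0 row_of_def)
next
  case (Suc c)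
  show ?case
  proof (cases "f (Suc c)")
    case (Some v)
    have "\<exists>v. greedy_count a b c < sum a {..v} \<and> sum b {..v} \<le> c" if "occ f c = greedy_count a b c"
      using row_of_value(2)[OF assms(1) Some] assms(2)[OF Some] that by auto
    then show ?thesis using Suc Some by (cases "occ f c = greedy_count a b c") (auto simp: occ_Suc)
  qed (use Suc in \<open>auto simp: occ_Suc\<close>)
qed

lemma greedy_count_0:
  assumes X: "\<And>v. v > X \<Longrightarrow> a v = 0"
  shows "greedy_count a (\<lambda>_. 0) c = min c (sum a {..X})"
proof (induction c)
  case (Suc c)
  have "sum a {..v} \<le> sum a {..X}" for v by (rule sum_le_support) (rule X)
  then have "(\<exists>v. k < sum a {..v}) \<longleftrightarrow> k < sum a {..X}" for k
    using less_le_trans by blast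
  then show ?case using Suc by auto
qed simp

section \<open>Which cell the crystal operator moves\<close>

text \<open>This is the signature (bracketing) function of two rows, where a lower entry is matched
  with a strictly smaller upper one. Its maximum counts the unmatched lower cells; it takes negative
  values, hence the integers.\<close>

definition excess :: "(nat \<Rightarrow> nat) \<Rightarrow> (nat \<Rightarrow> nat) \<Rightarrow> nat \<Rightarrow> int" where
  "excess a b z = int (sum b {..z}) - int (sum a {..<z})"

text \<open>Since \<open>z = 0\<close> is among the smaller arguments and the excess there is
  nonnegative, \<open>0 < x\<close> forces the maximum to be positive.\<close>

definition selected :: "(nat \<Rightarrow> nat) \<Rightarrow> (nat \<Rightarrow> nat) \<Rightarrow> nat \<Rightarrow> bool" where
  "selected a b x \<longleftrightarrow> 0 < x \<and> (\<forall>z<x. excess a b z < excess a b x) \<and>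
     (\<forall>z>x. excess a b z \<le> excess a b x)"

lemma selected_unique: "selected a b x \<Longrightarrow> selected a b y \<Longrightarrow> x = y"
  unfolding selected_def by (metis linorder_less_linear not_le)

text \<open>An upper entry \<open>v\<close> with \<open>z \<le> v\<close> can only be placed beyond
  column \<open>sum b {..z}\<close>, so up to that column all placed entries are smaller than
  \<open>z\<close>.\<close>

lemma greedy_count_le:
  "c \<le> sum b {..z} \<Longrightarrow> greedy_count a b c \<le> sum a {..<z}"
proof (induction c)
  case (Suc c)
  show ?case
  proof (rule ccontr)
    assume *: "\<not> ?thesis"
    then have eq: "greedy_count a b c = sum a {..<z}" using Suc by (auto split: if_splits)
    obtain v where v: "greedy_count a b c < sum a {..v}" "sum b {..v} \<le> c"
      using * Suc by (auto split: if_splits)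
    have "z \<le> v"
      using v(1) eq sum_le_lessThan[of v z a] by (cases "v < z") auto
    then show False using sum_le_atMost[of z v b] v(2) Suc.prems by simp
  qed
qed simp

text \<open>The number of upper blanks in the first \<open>sum b {..z}\<close> columns bounds the
  excess at \<open>z\<close>. Within the packed lower row this number grows exactly at the columns
  of \<open>C\<close>, so it is constant after the right-most of them; the lower entry there attains
  the bound, and smaller entries only reach columns further left.\<close>

lemma greedy_selects:
  assumes aX: "\<And>v. v > X \<Longrightarrow> a v = 0" and bX: "\<And>v. v > X \<Longrightarrow> b v = 0" and b0: "b 0 = 0"
  defines "C \<equiv> {c. greedy b (\<lambda>_. 0) c \<noteq> None \<and> greedy a b c = None}"
  shows "C = {} \<Longrightarrow> excess a b z \<le> 0"
    and "C \<noteq> {} \<Longrightarrow> selected a b (the (greedy b (\<lambda>_. 0) (Max C)))"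
proof -
  let ?B = "sum b {..X}"
  \<comment> \<open>\<open>g c\<close> is the number of blanks of the upper row in columns 1 to
    \<open>c\<close>.\<close>
  define g where "g c = int c - int (greedy_count a b c)" for c
  have cb: "greedy_count b (\<lambda>_. 0) c = min c ?B" for c by (rule greedy_count_0) (rule bX)
  have le: "sum b {..v} \<le> ?B" for v by (rule sum_le_support) (rule bX)
  have low: "greedy b (\<lambda>_. 0) (Suc c) \<noteq> None \<longleftrightarrow> c < ?B" for c
    using le[THEN less_le_trans[rotated]] by (auto simp del: not_None_eq simp: greedy_eq_None cb min_def)
  have gmono: "c \<le> d \<Longrightarrow> g c \<le> g d" for c d
    by (rule lift_Suc_mono_le) (auto simp: g_def)
  have exg: "excess a b z \<le> g (sum b {..z})" for z
    using greedy_count_le[of "sum b {..z}" b z a] unfolding excess_def g_def by linarith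
  have flat: "g d = g c" if "c \<le> d" "\<And>e. c \<le> e \<Longrightarrow> e < d \<Longrightarrow> Suc e \<notin> C" "d \<le> ?B" for c d
    using that
  proof (induction d rule: dec_induct)
    case (step e)
    then have "Suc e \<notin> C" "e < ?B" by auto
    then have "greedy a b (Suc e) \<noteq> None" using low[of e] unfolding C_def mem_Collect_eq by (metis (lifting))
    then have "g (Suc e) = g e" using greedy_eq_None[of a b e] by (auto simp: g_def)
    then show ?case using step by simp
  qed simp
  show "excess a b z \<le> 0" if "C = {}"
  proof -
    have "g ?B = g 0" using that by (intro flat) auto
    then show ?thesis using exg[of z] gmono[OF le[of z]] by (simp add: g_def)
  qed
  assume ne: "C \<noteq> {}"
  have "finite {c. greedy b (\<lambda>_. 0) c \<noteq> None}"
    using row_of_greedy[of X b "\<lambda>_. 0"] bX by (simp add: row_of_def)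
  then have fin: "finite C" by (auto simp: C_def elim: rev_finite_subset)
  then have mem: "Max C \<in> C" using ne by simp
  then obtain c where c: "Max C = Suc c" by (cases "Max C") (auto simp: C_def)
  have cB: "c < ?B" using low[of c] mem c by (simp add: C_def)
  obtain x where x: "greedy b (\<lambda>_. 0) (Suc c) = Some x" using mem c by (auto simp: C_def)
  have xb: "sum b {..<x} \<le> c" "c < sum b {..x}"
    using greedy_SomeD[OF x] cb[of c] cB by auto
  have x0: "0 < x" using xb(2) b0 by (cases x) auto
  have np: "sum b {..v} > c" if "greedy_count a b c < sum a {..v}" for v
    using mem c that by (auto simp: C_def greedy_eq_None not_le)
  \<comment> \<open>If an upper entry below \<open>x\<close> were still unplaced, the blank at
    column \<open>Suc c\<close> would force more than \<open>c\<close> lower entries below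
    \<open>x\<close>, but there are at most \<open>c\<close> of them.\<close>
  have ca: "sum a {..<x} \<le> greedy_count a b c"
  proof (rule ccontr)
    assume "\<not> ?thesis"
    then have "c < sum b {..x - 1}" using np[of "x - 1"] x0
      by (simp add: lessThan_Suc_atMost[symmetric])
    then show False using xb(1) x0 by (simp add: lessThan_Suc_atMost[symmetric])
  qed
  have jump: "g (Suc c) = g c + 1" using mem c by (auto simp: C_def g_def greedy_eq_None)
  have top: "g ?B = g (Suc c)"
  proof (rule flat)
    fix e assume "Suc c \<le> e"
    then show "Suc e \<notin> C" using Max_ge[OF fin, of "Suc e"] c by auto
  qed (use cB in auto)
  have ex: "g (Suc c) \<le> excess a b x"
    using xb(2) ca jump unfolding excess_def g_def by linarith
  have "excess a b z < excess a b x" if "z < x" for z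
  proof -
    have "sum b {..z} \<le> c" using sum_le_lessThan[OF that, of b] xb(1) by simp
    then show ?thesis using gmono[of "sum b {..z}" c] exg[of z] ex jump by simp
  qed
  moreover have "excess a b z \<le> excess a b x" for z
    using exg[of z] gmono[OF le[of z]] top ex by simp
  ultimately show "selected a b (the (greedy b (\<lambda>_. 0) (Max C)))"
    using x0 x c by (simp add: selected_def)
qed

section \<open>Ptableaux as matrices\<close>

text \<open>Columns index only the arrays; as a matrix, \<open>M x r\<close> is the number of \<open>x\<close>'s in row \<open>r\<close>.\<close>

definition valid_matrix :: "nat \<Rightarrow> (nat \<Rightarrow> nat \<Rightarrow> nat) \<Rightarrow> bool" where
  "valid_matrix n M \<longleftrightarrow> (\<exists>X. \<forall>x r. M x r \<noteq> 0 \<longrightarrow> 1 \<le> x \<and> x \<le> X \<and> 1 \<le> r \<and> r \<le> n)"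

text \<open>The set has the shape in which \<open>cr_e\<close> returns its result.\<close>

definition ptab_of :: "nat \<Rightarrow> (nat \<Rightarrow> nat \<Rightarrow> nat) \<Rightarrow> ptab" where
  "ptab_of n M = {B. ptableau n B \<and> num B = M}"

definition move_up :: "nat \<Rightarrow> nat \<Rightarrow> (nat \<Rightarrow> nat \<Rightarrow> nat) \<Rightarrow> nat \<Rightarrow> nat \<Rightarrow> nat" where
  "move_up i x M = M(x := (M x)(i := M x i + 1, i + 1 := M x (i + 1) - 1))"

lemma row_equiv_iff: "row_equiv A B \<longleftrightarrow> num A = num B"
  by (auto simp: row_equiv_def fun_eq_iff)

lemma validD:
  assumes "valid_matrix n M"
  shows "M 0 r = 0" "M x 0 = 0" "n < r \<Longrightarrow> M x r = 0"
  using assms unfolding valid_matrix_def by (metis not_one_le_zero, metis not_one_le_zero, metis not_less)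

lemma valid_bound:
  assumes "valid_matrix n M"
  obtains X where "\<And>x r. X < x \<Longrightarrow> M x r = 0"
  using assms unfolding valid_matrix_def by (metis not_less)

lemma pt_filling_row_of:
  assumes "pt_filling n m A"
  shows "row_of (\<lambda>x. num A x r) (A r)"
proof -
  have "{c. A r c \<noteq> None} \<subseteq> {1..m}" using assms unfolding pt_filling_def by blast
  then have "finite {c. A r c \<noteq> None}" by (rule finite_subset) simp
  moreover have "A r 0 = None"
    using assms unfolding pt_filling_def by (metis atLeastAtMost_iff not_None_eq not_one_le_zero)
  moreover have "x \<le> y" if "A r c = Some x" "A r d = Some y" "c \<le> d" for c d x y
    using assms that unfolding pt_filling_def by blast
  ultimately show ?thesis unfolding row_of_def num_def by blast
qed

lemma num_ne_0:
  assumes "pt_filling n m A"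
  shows "num A x r \<noteq> 0 \<longleftrightarrow> (\<exists>c. A r c = Some x)"
proof -
  have "finite {c. A r c = Some x}"
    using pt_filling_row_of[OF assms, of r] by (auto simp: row_of_def elim: rev_finite_subset)
  then show ?thesis by (auto simp: num_def)
qed

lemma pt_filling_valid:
  assumes "pt_filling n m A"
  shows "valid_matrix n (num A)"
proof -
  have S: "r \<in> {1..n} \<and> c \<in> {1..m} \<and> 1 \<le> x" if "A r c = Some x" for r c x
    using assms that unfolding pt_filling_def by blast
  \<comment> \<open>At blanks \<open>the\<close> contributes unspecified values; they are harmless,
    as only a finite set containing all entries is wanted.\<close>
  define V where "V = (\<lambda>(r, c). the (A r c)) ` ({1..n} \<times> {1..m})"
  have fin: "finite V" by (simp add: V_def)
  have "x \<le> Max V" if "A r c = Some x" for r c x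
  proof -
    have "(r, c) \<in> {1..n} \<times> {1..m}" using S[OF that] by simp
    then have "x \<in> V" unfolding V_def using that by force
    then show ?thesis using fin by simp
  qed
  then show ?thesis unfolding valid_matrix_def num_ne_0[OF assms] using S
    by (metis atLeastAtMost_iff)
qed

text \<open>Induction on the number of cells: take away one copy of the largest entry
  \<open>x\<close> from the topmost row containing it, fill the rest, and put the copy into a new
  last column. Maximality of \<open>x\<close> protects the order, and the choice of the topmost row
  protects the horizontal strip. The number of columns is not minimal here.\<close>

lemma valid_ex_filling:
  assumes "valid_matrix n M"
  shows "\<exists>m A. pt_filling n m A \<and> num A = M"
proof -
  obtain X where X: "\<And>x r. M x r \<noteq> 0 \<Longrightarrow> 1 \<le> x \<and> x \<le> X \<and> 1 \<le> r \<and> r \<le> n"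
    using assms unfolding valid_matrix_def by blast
  then show ?thesis
  proof (induction "\<Sum>x\<in>{1..X}. \<Sum>r\<in>{1..n}. M x r" arbitrary: M)
    case 0
    have "M x r = 0" for x r
    proof (rule ccontr)
      assume "M x r \<noteq> 0"
      moreover from this have "x \<in> {1..X}" "r \<in> {1..n}" using 0(2) by auto
      ultimately show False using 0(1) by simp
    qed
    then have "num (\<lambda>_ _. None) = M" by (simp add: num_def fun_eq_iff)
    moreover have "pt_filling n 0 (\<lambda>_ _. None)" by (simp add: pt_filling_def)
    ultimately show ?case by blast
  next
    case (Suc t)
    define x where "x = (GREATEST x. \<exists>r. M x r \<noteq> 0)"
    define r where "r = (LEAST r. M x r \<noteq> 0)"
    have "\<exists>x r. M x r \<noteq> 0"
    proof (rule ccontr)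
      assume "\<nexists>x r. M x r \<noteq> 0"
      then show False using Suc(2) by simp
    qed
    then have ex: "\<exists>r. M x r \<noteq> 0"
      unfolding x_def by (rule GreatestI_ex_nat) (use Suc(3) in blast)
    have xmax: "y \<le> x" if "M y s \<noteq> 0" for y s
      unfolding x_def by (rule Greatest_le_nat) (use Suc(3) that in blast)+
    have r: "M x r \<noteq> 0" unfolding r_def using ex by (rule LeastI_ex)
    have rmin: "r \<le> s" if "M x s \<noteq> 0" for s
      unfolding r_def using that by (rule Least_le)
    have xr: "1 \<le> x" "x \<le> X" "1 \<le> r" "r \<le> n" using Suc(3)[OF r] by auto
    define M' where "M' = M(x := (M x)(r := M x r - 1))"
    have M: "M = M'(x := (M' x)(r := M' x r + 1))"
      using r by (auto simp: M'_def fun_eq_iff)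
    have "(\<Sum>s\<in>{1..n}. M x s) = Suc (\<Sum>s\<in>{1..n}. M' x s)"
      using xr r by (simp add: sum.remove[of _ r] M'_def)
    moreover have "M y = M' y" if "y \<noteq> x" for y using that by (simp add: M'_def)
    ultimately have "(\<Sum>y\<in>{1..X}. \<Sum>s\<in>{1..n}. M y s) = Suc (\<Sum>y\<in>{1..X}. \<Sum>s\<in>{1..n}. M' y s)"
      using xr by (simp add: sum.remove[of _ x])
    then have t: "t = (\<Sum>y\<in>{1..X}. \<Sum>s\<in>{1..n}. M' y s)" using Suc(2) by simp
    have le: "M' y s \<noteq> 0 \<Longrightarrow> M y s \<noteq> 0" for y s by (auto simp: M'_def split: if_splits)
    obtain m A where A: "pt_filling n m A" "num A = M'"
      using Suc(1)[OF t] Suc(3) le by blast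
    have A1: "s \<in> {1..n} \<and> c \<in> {1..m} \<and> 1 \<le> y" if "A s c = Some y" for s c y
      using A(1) that unfolding pt_filling_def by blast
    have A2: "y \<le> z" if "A s c = Some y" "A s' c' = Some z" "s \<le> s'" "c \<le> c'" for s c s' c' y z
      using A(1) that unfolding pt_filling_def by blast
    have A3: "c' < c" if "A s c = Some y" "A s' c' = Some y" "s < s'" for s c s' c' y
      using A(1) that unfolding pt_filling_def by blast
    have A4: "y \<le> x" if "A s c = Some y" for s c y
      using that A xmax le num_ne_0[OF A(1)] by metis
    have A5: "r \<le> s" if "A s c = Some x" for s c
      using that A rmin le num_ne_0[OF A(1)] by metis
    define B where "B = A(r := (A r)(Suc m := Some x))"
    have Bcase: "(s = r \<and> c = Suc m \<and> y = x) \<or> A s c = Some y" if "B s c = Some y" for s c y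
      using that by (auto simp: B_def split: if_splits)
    have "pt_filling n (Suc m) B"
      unfolding pt_filling_def
    proof (intro conjI allI impI)
      fix s c y assume "B s c = Some y"
      then show "s \<in> {1..n}" "c \<in> {1..Suc m}" "1 \<le> y" using Bcase[of s c y] A1[of s c y] xr by auto
    next
      fix s c s' c' y z assume "B s c = Some y \<and> B s' c' = Some z \<and> s \<le> s' \<and> c \<le> c'"
      then show "y \<le> z" using Bcase[of s c y] Bcase[of s' c' z] A1[of s' c' z] A2[of s c y s' c' z]
        A4[of s c y] by auto
    next
      fix s c s' c' y assume "B s c = Some y \<and> B s' c' = Some y \<and> s < s'"
      then show "c' < c" using Bcase[of s c y] Bcase[of s' c' y] A1[of s' c' y] A3[of s c y s' c']
        A5[of s c] by auto
    qed
    moreover have "num B = M"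
    proof (intro ext)
      fix y s
      have "A r (Suc m) = None" using A1[of r "Suc m"] by (cases "A r (Suc m)") auto
      then have "{c. B s c = Some y} = (if s = r \<and> y = x then insert (Suc m) {c. A s c = Some y}
          else {c. A s c = Some y})" by (auto simp: B_def)
      moreover have "finite {c. A s c = Some y}"
        by (rule finite_subset[of _ "{1..m}"]) (use A1 in auto)
      moreover have "Suc m \<notin> {c. A s c = Some y}" using A1[of s "Suc m" y] by auto
      ultimately have "num B y s = (if s = r \<and> y = x then Suc (num A y s) else num A y s)"
        by (auto simp: num_def)
      then show "num B y s = M y s" using A(2) M by (simp add: fun_eq_iff)
    qed
    ultimately show ?case by blast
  qed
qed

lemma valid_ex_ptableau:
  assumes "valid_matrix n M"
  shows "\<exists>A. ptableau n A \<and> num A = M"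
proof -
  define m where "m = (LEAST m. \<exists>A. pt_filling n m A \<and> num A = M)"
  have "\<exists>A. pt_filling n m A \<and> num A = M"
    unfolding m_def using valid_ex_filling[OF assms] by (rule LeastI_ex)
  then obtain A where A: "pt_filling n m A" "num A = M" by blast
  have "m \<le> m'" if "pt_filling n m' B" "row_equiv A B" for m' B
    unfolding m_def by (rule Least_le) (use that A in \<open>auto simp: row_equiv_iff\<close>)
  then show ?thesis using A unfolding ptableau_def by blast
qed

lemma ptableau_valid: "ptableau n A \<Longrightarrow> valid_matrix n (num A)"
  unfolding ptableau_def using pt_filling_valid by blast

lemma PTab_iff: "P \<in> PTab n \<longleftrightarrow> (\<exists>M. valid_matrix n M \<and> P = ptab_of n M)"
proof
  assume "P \<in> PTab n"
  then obtain A where "ptableau n A" "P = {B. ptableau n B \<and> num A = num B}"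
    unfolding PTab_def by (auto simp: quotient_def row_equiv_iff Image_def)
  then have "ptableau n A" "P = ptab_of n (num A)" by (auto simp: ptab_of_def)
  then show "\<exists>M. valid_matrix n M \<and> P = ptab_of n M" using ptableau_valid by blast
next
  assume "\<exists>M. valid_matrix n M \<and> P = ptab_of n M"
  then obtain M A where "P = ptab_of n M" "ptableau n A" "num A = M"
    using valid_ex_ptableau by blast
  then show "P \<in> PTab n"
    unfolding PTab_def
    by (intro quotientI[THEN back_subst[of "\<lambda>P. P \<in> _"], of A])
       (auto simp: ptab_of_def row_equiv_iff Image_def)
qed

text \<open>All members of the class share their counts, so the choice made by \<open>rep\<close>
  does not matter.\<close>

lemma num_rep_ptab_of: "valid_matrix n M \<Longrightarrow> num (rep (ptab_of n M)) = M"
  unfolding rep_def using valid_ex_ptableau[of n M]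
  by (metis (mono_tags, lifting) ptab_of_def mem_Collect_eq someI_ex)

lemma entries_ptab_of: "valid_matrix n M \<Longrightarrow> entries (ptab_of n M) = M"
  by (simp add: entries_def fun_eq_iff num_rep_ptab_of)

section \<open>The left-justified form of two rows\<close>

text \<open>The last fact is the constraint of the greedy rule. A lower entry \<open>w\<close> with
  \<open>w \<le> v\<close> weakly to the right of an upper \<open>v\<close> would have to equal
  \<open>v\<close> by the order condition, and the horizontal strip condition then puts it strictly
  to the left.\<close>

lemma two_rowsD:
  assumes "two_rows i A L"
  shows "row_of (\<lambda>x. num A x i) (L i)" "row_of (\<lambda>x. num A x (i + 1)) (L (i + 1))"
    and "r \<noteq> i \<Longrightarrow> r \<noteq> i + 1 \<Longrightarrow> L r = (\<lambda>_. None)"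
    and "L i (Suc c) = Some v \<Longrightarrow> (\<Sum>x\<le>v. num A x (i + 1)) \<le> c"
proof -
  obtain m where m: "pt_filling (i + 1) m L" using assms unfolding two_rows_def by blast
  have F2: "x \<le> y" if "L r c = Some x" "L r' c' = Some y" "r \<le> r'" "c \<le> c'" for r c r' c' x y
    using m that unfolding pt_filling_def by blast
  have F3: "c' < c" if "L r c = Some x" "L r' c' = Some x" "r < r'" for r c r' c' x
    using m that unfolding pt_filling_def by blast
  have n: "num L x r = (if r = i \<or> r = i + 1 then num A x r else 0)" for x r
    using assms unfolding two_rows_def by blast
  show "row_of (\<lambda>x. num A x i) (L i)" using pt_filling_row_of[OF m, of i] by (simp add: n)
  show low: "row_of (\<lambda>x. num A x (i + 1)) (L (i + 1))"
    using pt_filling_row_of[OF m, of "i + 1"] by (simp add: n)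
  show "L r = (\<lambda>_. None)" if "r \<noteq> i" "r \<noteq> i + 1"
  proof
    fix c
    show "L r c = None" using num_ne_0[OF m, of _ r] n[of _ r] that by (cases "L r c") auto
  qed
  assume v: "L i (Suc c) = Some v"
  have "d \<in> {1..c}" if "L (i + 1) d = Some w" "w \<le> v" for d w
  proof -
    have "1 \<le> d" using m that(1) unfolding pt_filling_def by (metis atLeastAtMost_iff)
    moreover have "d < Suc c"
    proof (rule ccontr)
      assume "\<not> d < Suc c"
      then have "v \<le> w" using F2[OF v that(1)] by simp
      then have "w = v" using that(2) by simp
      then show False using F3[OF v, of "i + 1" d] that(1) \<open>\<not> d < Suc c\<close> by simp
    qed
    ultimately show ?thesis by simp
  qed
  then have "{d. \<exists>w\<in>{..v}. L (i + 1) d = Some w} \<subseteq> {1..c}" by blast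
  then have "card {d. \<exists>w\<in>{..v}. L (i + 1) d = Some w} \<le> card {1..c}" by (intro card_mono) auto
  then show "(\<Sum>x\<le>v. num A x (i + 1)) \<le> c" using row_of_card[OF low] by simp
qed

definition greedy_pair :: "nat \<Rightarrow> (nat \<Rightarrow> nat) \<Rightarrow> (nat \<Rightarrow> nat) \<Rightarrow> ptarray" where
  "greedy_pair i a b = (\<lambda>_ _. None)(i := greedy a b, i + 1 := greedy b (\<lambda>_. 0))"

lemma two_rows_greedy_pair:
  assumes "valid_matrix n (num A)" "1 \<le> i"
  shows "two_rows i A (greedy_pair i (\<lambda>x. num A x i) (\<lambda>x. num A x (i + 1)))"
proof -
  let ?a = "\<lambda>x. num A x i" and ?b = "\<lambda>x. num A x (i + 1)"
  let ?f = "greedy ?a ?b" and ?g = "greedy ?b (\<lambda>_. 0)"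
  let ?L = "greedy_pair i ?a ?b"
  obtain X where X: "\<And>x r. X < x \<Longrightarrow> num A x r = 0" using valid_bound[OF assms(1)] by blast
  have rf: "row_of ?a ?f" and rg: "row_of ?b ?g" by (rule row_of_greedy, rule X, assumption)+
  \<comment> \<open>The element 0 keeps \<open>Max\<close> meaningful when both rows are
    empty.\<close>
  define m where "m = Max ({c. ?f c \<noteq> None} \<union> {c. ?g c \<noteq> None} \<union> {0})"
  have fin: "finite ({c. ?f c \<noteq> None} \<union> {c. ?g c \<noteq> None} \<union> {0})"
    using rf rg by (simp add: row_of_def)
  have m: "?f c = Some x \<Longrightarrow> c \<le> m" "?g c = Some x \<Longrightarrow> c \<le> m" for c x
    unfolding m_def by (rule Max_ge[OF fin], simp)+
  have pos: "greedy a b c = Some x \<Longrightarrow> 1 \<le> c" for a b c x by (cases c) auto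
  have "0 < x" if v: "greedy a b c = Some x" "a 0 = 0" for a b c x
  proof -
    obtain d where "c = Suc d" using v(1) by (cases c) auto
    then have "greedy_count a b d < sum a {..x}" using greedy_SomeD(2) v(1) by blast
    then show ?thesis using v(2) by (cases x) auto
  qed
  then have vpos: "?f c = Some x \<Longrightarrow> 1 \<le> x" "?g c = Some x \<Longrightarrow> 1 \<le> x" for c x
    using validD(1)[OF assms(1)] Suc_le_eq by auto
  \<comment> \<open>In the packed lower row, \<open>y\<close> stands in a column at most
    \<open>sum b {..y}\<close> with \<open>b\<close> the lower content, whereas the upper
    \<open>x\<close> stands beyond column \<open>sum b {..x}\<close>. Both the order and the strip
    condition between the rows follow.\<close>
  have coupled: "d < c" if fg: "?f c = Some x" "?g d = Some y" and yx: "y \<le> x" for c d x y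
  proof -
    obtain c' d' where cd: "c = Suc c'" "d = Suc d'" using fg by (cases c; cases d) auto
    have "sum ?b {..x} \<le> c'" using fg cd greedy_SomeD(3) by blast
    moreover have "greedy_count ?b (\<lambda>_. 0) d' < sum ?b {..y}" using fg cd greedy_SomeD(2) by blast
    moreover have "greedy_count ?b (\<lambda>_. 0) d' = min d' (sum ?b {..X})"
      by (rule greedy_count_0) (rule X)
    moreover have "sum ?b {..y} \<le> sum ?b {..X}" by (rule sum_le_support) (rule X)
    ultimately show ?thesis using sum_le_atMost[OF yx, of ?b] cd by simp
  qed
  have Lcase: "(r = i \<and> ?f c = Some x) \<or> (r = i + 1 \<and> ?g c = Some x)" if "?L r c = Some x" for r c x
    using that by (auto simp: greedy_pair_def split: if_splits)
  have mono: "x \<le> y" if "greedy a b c = Some x" "greedy a b d = Some y" "c \<le> d" for a b c d x y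
    using that greedy_mono by blast
  have "pt_filling (i + 1) m ?L"
    unfolding pt_filling_def
  proof (intro conjI allI impI)
    fix r c x assume "?L r c = Some x"
    then show "r \<in> {1..i + 1}" "c \<in> {1..m}" "1 \<le> x"
      using Lcase[of r c x] assms(2) m[of c x] pos vpos[of c x] by auto
  next
    fix r c r' c' x y assume "?L r c = Some x \<and> ?L r' c' = Some y \<and> r \<le> r' \<and> c \<le> c'"
    then show "x \<le> y" using Lcase[of r c x] Lcase[of r' c' y] mono[of _ _ c x c' y]
      coupled[of c x c' y] nat_le_linear[of x y] by auto
  next
    fix r c r' c' x assume "?L r c = Some x \<and> ?L r' c' = Some x \<and> r < r'"
    then show "c' < c" using Lcase[of r c x] Lcase[of r' c' x] coupled[of c x c' x] by auto
  qed
  moreover have "num ?L x r = (if r = i \<or> r = i + 1 then num A x r else 0)" for x r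
    using rf rg by (auto simp: num_def greedy_pair_def row_of_def)
  ultimately show ?thesis unfolding two_rows_def by blast
qed

text \<open>The greedy pair maximises every prefix count. Any other maximiser has the same counts
  and the same contents, hence the same rows; this settles the definite description in
  \<open>cr_e\<close>.\<close>

lemma left_justified_iff:
  assumes "valid_matrix n (num A)" "1 \<le> i"
  shows "left_justified i A L \<longleftrightarrow> L = greedy_pair i (\<lambda>x. num A x i) (\<lambda>x. num A x (i + 1))"
    (is "_ \<longleftrightarrow> L = ?L")
proof -
  have le: "occ (L' r) c \<le> occ (?L r) c" if "two_rows i A L'" for L' r c
  proof -
    note D = two_rowsD[OF that]
    consider "r = i" | "r = i + 1" | "r \<noteq> i" "r \<noteq> i + 1" by blast
    then show ?thesis
    proof cases
      case 1
      then show ?thesis using occ_le_greedy_count[OF D(1) D(4)] by (simp add: greedy_pair_def occ_greedy)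
    next
      case 2
      then show ?thesis using occ_le_greedy_count[OF D(2), of "\<lambda>_. 0"] by (simp add: greedy_pair_def occ_greedy)
    next
      case 3
      then show ?thesis using D(3) by (simp add: occ_def)
    qed
  qed
  have L: "two_rows i A ?L" by (rule two_rows_greedy_pair[OF assms])
  have "L = ?L" if lj: "left_justified i A L"
  proof
    fix r
    have two: "two_rows i A L" using lj by (simp add: left_justified_def)
    have eq: "occ (L r) c = occ (?L r) c" for r c
      using lj L le[OF two, of r c] unfolding left_justified_def occ_def
      by (meson le_antisym)
    note D = two_rowsD[OF two] and D' = two_rowsD[OF L]
    consider "r = i" | "r = i + 1" | "r \<noteq> i" "r \<noteq> i + 1" by blast
    then show "L r = ?L r"
    proof cases
      case 1
      then show ?thesis using row_of_unique[OF D(1) D'(1)] eq by simp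
    next
      case 2
      then show ?thesis using row_of_unique[OF D(2) D'(2)] eq by simp
    next
      case 3
      then show ?thesis using D(3) D'(3) by simp
    qed
  qed
  then show ?thesis using L le by (auto simp: left_justified_def occ_def)
qed

text \<open>The alternatives exclude each other, because a selected entry has positive excess; so
  the matrix alone decides which one holds.\<close>

lemma cr_e_ptab_of:
  assumes M: "valid_matrix n M" and i: "1 \<le> i"
  defines "a \<equiv> \<lambda>x. M x i" and "b \<equiv> \<lambda>x. M x (i + 1)"
  shows "(cr_e n i (ptab_of n M) = None \<and> (\<forall>z. excess a b z \<le> 0)) \<or>
    (\<exists>x. selected a b x \<and> cr_e n i (ptab_of n M) = Some (ptab_of n (move_up i x M)))"
proof -
  define A where "A = rep (ptab_of n M)"
  have nA: "num A = M" unfolding A_def using M by (rule num_rep_ptab_of)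
  have the: "(THE L. left_justified i A L) = greedy_pair i a b"
    using left_justified_iff[of n A i] M i nA by (simp add: a_def b_def)
  define C where "C = {c. greedy b (\<lambda>_. 0) c \<noteq> None \<and> greedy a b c = None}"
  have C: "{c. greedy_pair i a b (i + 1) c \<noteq> None \<and> greedy_pair i a b i c = None} = C"
    by (simp add: greedy_pair_def C_def)
  obtain X where X: "\<And>x r. X < x \<Longrightarrow> M x r = 0" using valid_bound[OF M] by blast
  have aX: "\<And>v. v > X \<Longrightarrow> a v = 0" "\<And>v. v > X \<Longrightarrow> b v = 0" and b0: "b 0 = 0"
    using X validD(1)[OF M] by (simp_all add: a_def b_def)
  note G = greedy_selects[of X a b, OF aX b0, folded C_def]
  have eq: "cr_e n i (ptab_of n M) = (if C = {} then None
    else Some (ptab_of n (move_up i (the (greedy b (\<lambda>_. 0) (Max C))) M)))"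
    unfolding cr_e_def Let_def A_def[symmetric] the C
    by (simp add: nA ptab_of_def move_up_def greedy_pair_def)
  show ?thesis
  proof (cases "C = {}")
    case True
    then show ?thesis using G(1) eq by simp
  next
    case False
    then show ?thesis using G(2) eq by auto
  qed
qed

section \<open>The word condition and the distinguished crystal\<close>

lemma PTab_entries:
  assumes "P \<in> PTab n"
  shows "valid_matrix n (entries P)" "ptab_of n (entries P) = P"
  using assms by (auto simp: PTab_iff entries_ptab_of)

section \<open>Invariants of irreducible crystals\<close>

text \<open>Compare the excess at \<open>x\<close> with its neighbours: the differences are
  \<open>b x - a (x - 1)\<close> and \<open>b (Suc x) - a x\<close>.\<close>

lemma selected_step:
  assumes "selected a b x"
  shows "a (x - 1) < b x" "b (Suc x) \<le> a x"
proof -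
  have "excess a b (x - 1) < excess a b x" "0 < x" using assms by (auto simp: selected_def)
  then show "a (x - 1) < b x"
    by (cases x) (simp_all add: excess_def lessThan_Suc_atMost[symmetric])
  have "excess a b (Suc x) \<le> excess a b x" using assms by (auto simp: selected_def)
  then show "b (Suc x) \<le> a x" by (simp add: excess_def lessThan_Suc_atMost[symmetric])
qed

text \<open>A prefix of rows ending below row \<open>i\<close> contains both positions of the moved
  cell, and one ending above contains neither.\<close>

lemma sum_move_up:
  assumes "1 \<le> i" "0 < M x (i + 1)"
  shows "sum (move_up i x M y) {..r} = sum (M y) {..r} + (if y = x \<and> r = i then 1 else 0)"
  using assms by (induction r) (auto simp: move_up_def)

lemma valid_move_up:
  assumes "valid_matrix n M" "1 \<le> i" "0 < M x (i + 1)"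
  shows "valid_matrix n (move_up i x M)"
proof -
  obtain X where X: "\<And>y r. M y r \<noteq> 0 \<Longrightarrow> 1 \<le> y \<and> y \<le> X \<and> 1 \<le> r \<and> r \<le> n"
    using assms(1) unfolding valid_matrix_def by blast
  have "M y r \<noteq> 0 \<or> (y = x \<and> r = i)" if "move_up i x M y r \<noteq> 0" for y r
    using that assms(3) by (auto simp: move_up_def split: if_splits)
  then show ?thesis unfolding valid_matrix_def
    using X X[of x "i + 1"] assms(2,3) by (intro exI[of _ X]) fastforce
qed

text \<open>This is the lattice (Yamanouchi) condition for the reading from the top row down, each
  row from right to left. As row 0 is empty, \<open>r = 0\<close> keeps entries above 1 out of row
  1.\<close>

definition word_cond :: "(nat \<Rightarrow> nat \<Rightarrow> nat) \<Rightarrow> bool" where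
  "word_cond M \<longleftrightarrow> (\<forall>x r. 1 \<le> x \<longrightarrow> sum (M (Suc x)) {..Suc r} \<le> sum (M x) {..r})"

text \<open>Only the prefix count of \<open>x\<close> at row \<open>i\<close> changes, so only one
  inequality is at risk in each direction. Each follows from the inequality one row further down or
  up, respectively, by the matching half of \<open>selected_step\<close>.\<close>

lemma word_cond_move_up:
  assumes i: "1 \<le> i" and selected: "selected (\<lambda>y. M y i) (\<lambda>y. M y (i + 1)) x"
  shows "word_cond (move_up i x M) \<longleftrightarrow> word_cond M"
proof -
  note step = selected_step[OF selected]
  obtain j where j: "i = Suc j" using i by (cases i) auto
  have S: "sum (move_up i x M y) {..r} = sum (M y) {..r} + (if y = x \<and> r = i then 1 else 0)" for y r
    by (rule sum_move_up) (use i step in auto)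
  show ?thesis
  proof
    assume W: "word_cond M"
    show "word_cond (move_up i x M)"
      unfolding word_cond_def
    proof (intro allI impI)
      fix y r :: nat assume y: "1 \<le> y"
      have W': "sum (M (Suc y)) {..Suc r} \<le> sum (M y) {..r}" for r
        using W y by (simp add: word_cond_def)
      show "sum (move_up i x M (Suc y)) {..Suc r} \<le> sum (move_up i x M y) {..r}"
      proof (cases "Suc y = x \<and> Suc r = i")
        case True
        then show ?thesis using W'[of i] step(1) by (auto simp: S)
      next
        case False
        then show ?thesis using W'[of r] by (auto simp: S simp del: sum.atMost_Suc)
      qed
    qed
  next
    assume W: "word_cond (move_up i x M)"
    show "word_cond M"
      unfolding word_cond_def
    proof (intro allI impI)
      fix y r :: nat assume y: "1 \<le> y"
      have W': "sum (move_up i x M (Suc y)) {..Suc r} \<le> sum (move_up i x M y) {..r}" for r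
        using W y by (simp add: word_cond_def)
      show "sum (M (Suc y)) {..Suc r} \<le> sum (M y) {..r}"
      proof (cases "y = x \<and> r = i")
        case True
        have "sum (M (Suc x)) {..Suc j} \<le> sum (M x) {..j}"
          using W'[of j] True unfolding S by (simp add: j del: sum.atMost_Suc)
        then show ?thesis using step(2) True j by simp
      next
        case False
        then show ?thesis using W'[of r] unfolding S by auto
      qed
    qed
  qed
qed

lemma cr_e_SomeD:
  assumes "P \<in> PTab n" "1 \<le> i" "cr_e n i P = Some Q"
  obtains x where "selected (\<lambda>y. entries P y i) (\<lambda>y. entries P y (i + 1)) x"
    "entries Q = move_up i x (entries P)" "Q \<in> PTab n"
proof -
  note V = PTab_entries[OF assms(1)]
  obtain x where x: "selected (\<lambda>y. entries P y i) (\<lambda>y. entries P y (i + 1)) x"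
    and Q: "Q = ptab_of n (move_up i x (entries P))"
    using cr_e_ptab_of[OF V(1) assms(2)] assms(3) V(2) by auto
  have "valid_matrix n (move_up i x (entries P))"
    using V(1) assms(2) by (rule valid_move_up) (use selected_step(1)[OF x] in auto)
  then show thesis using that x Q by (auto simp: entries_ptab_of PTab_iff)
qed

lemma cr_edges_invariant:
  assumes "(P, Q) \<in> cr_edges n"
  shows "word_cond (entries Q) \<longleftrightarrow> word_cond (entries P)"
    and "sum (entries Q y) {..n} = sum (entries P y) {..n}"
proof -
  obtain i where i: "1 \<le> i" "i < n" and P: "P \<in> PTab n" and e: "cr_e n i P = Some Q"
    using assms by (auto simp: cr_edges_def)
  obtain x where x: "selected (\<lambda>y. entries P y i) (\<lambda>y. entries P y (i + 1)) x"
    and Q: "entries Q = move_up i x (entries P)"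
    using cr_e_SomeD[OF P i(1) e] by blast
  show "word_cond (entries Q) \<longleftrightarrow> word_cond (entries P)"
    unfolding Q using i(1) x by (rule word_cond_move_up)
  show "sum (entries Q y) {..n} = sum (entries P y) {..n}"
    unfolding Q using i selected_step(1)[OF x] by (subst sum_move_up) auto
qed

text \<open>Edges are followed both ways, which is why preservation of the word condition had to be
  an equivalence.\<close>

lemma irr_crystal_invariant:
  assumes "Q \<in> irr_crystal n P"
  shows "word_cond (entries Q) \<longleftrightarrow> word_cond (entries P)"
    and "sum (entries Q y) {..n} = sum (entries P y) {..n}"
proof -
  have *: "(P, Q) \<in> (cr_edges n \<union> (cr_edges n)\<inverse>)\<^sup>*"
    using assms by (simp add: irr_crystal_def)
  show "word_cond (entries Q) \<longleftrightarrow> word_cond (entries P)"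
    using * by induction (use cr_edges_invariant(1) in auto)
  show "sum (entries Q y) {..n} = sum (entries P y) {..n}"
    using * by induction (use cr_edges_invariant(2) in auto)
qed

lemma irr_crystal_PTab:
  assumes "P \<in> PTab n" "Q \<in> irr_crystal n P"
  shows "Q \<in> PTab n"
proof -
  have "(P, Q) \<in> (cr_edges n \<union> (cr_edges n)\<inverse>)\<^sup>*" using assms(2) by (simp add: irr_crystal_def)
  then show ?thesis by induction (use assms(1) in \<open>auto simp: cr_edges_def\<close>)
qed

lemma irr_crystal_cr_e:
  assumes "P \<in> PTab n" "Q \<in> irr_crystal n P" "i \<in> {1..<n}" "cr_e n i Q = Some R"
  shows "R \<in> irr_crystal n P"
proof -
  have Q: "Q \<in> PTab n" using assms(1,2) by (rule irr_crystal_PTab)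
  then have "R \<in> PTab n" using cr_e_SomeD[OF Q _ assms(4)] assms(3) by auto
  then have "(Q, R) \<in> cr_edges n" using Q assms(3,4) by (auto simp: cr_edges_def)
  then show ?thesis using assms(2) by (auto simp: irr_crystal_def intro: rtrancl_into_rtrancl)
qed

section \<open>Diagonal highest weight elements\<close>

definition diagonal :: "(nat \<Rightarrow> nat \<Rightarrow> nat) \<Rightarrow> bool" where
  "diagonal M \<longleftrightarrow> (\<forall>x r. M x r \<noteq> 0 \<longrightarrow> x = r)"

lemma diagonal_sum: "diagonal M \<Longrightarrow> sum (M x) {..r} = (if x \<le> r then M x x else 0)"
proof -
  assume "diagonal M"
  then have "sum (M x) {..r} = (\<Sum>s\<le>r. if s = x then M x x else 0)"
    by (intro sum.cong) (auto simp: diagonal_def)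
  then show ?thesis by simp
qed

lemma highest_weight_excess:
  assumes "P \<in> PTab n" "highest_weight n P" "1 \<le> i" "i < n"
  shows "(\<Sum>y\<le>z. entries P y (i + 1)) \<le> (\<Sum>y<z. entries P y i)"
proof -
  have "cr_e n i P = None" using assms by (simp add: highest_weight_def)
  then have "excess (\<lambda>y. entries P y i) (\<lambda>y. entries P y (i + 1)) z \<le> 0"
    using cr_e_ptab_of[OF PTab_entries(1)[OF assms(1)] assms(3)] PTab_entries(2)[OF assms(1)] by auto
  then show ?thesis by (simp add: excess_def flip: of_nat_sum)
qed

text \<open>Induction on the entry: 1 does not occur in the empty row 0, and the word condition
  passes the absence of \<open>x\<close> from the rows above row \<open>x\<close> on to
  \<open>Suc x\<close>, one row lower.\<close>

lemma word_cond_upper: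
  assumes "valid_matrix n M" "word_cond M" "r < x"
  shows "M x r = 0"
proof -
  have "1 \<le> x \<Longrightarrow> sum (M x) {..<x} = 0" for x
  proof (induction x)
    case (Suc x)
    show ?case
    proof (cases x)
      case 0
      then show ?thesis using validD(2)[OF assms(1)] by simp
    next
      case (Suc r)
      have "sum (M (Suc x)) {..Suc r} \<le> sum (M x) {..r}"
        using assms(2) Suc by (simp add: word_cond_def del: sum.atMost_Suc)
      then show ?thesis using Suc.IH Suc by (simp only: lessThan_Suc_atMost)
    qed
  qed simp
  from this[of x] show ?thesis using assms(3) by simp
qed

text \<open>Induction on the row: at a highest weight element the excess at \<open>z = r\<close> is
  not positive, so entries at most \<open>r\<close> in row \<open>r + 1\<close> are no more numerous
  than entries below \<open>r\<close> in row \<open>r\<close>, of which there are none.\<close>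

lemma highest_weight_lower:
  assumes "P \<in> PTab n" "highest_weight n P" "x < r"
  shows "entries P x r = 0"
proof -
  note V = PTab_entries(1)[OF assms(1)]
  have "(\<Sum>y<r. entries P y r) = 0" if "1 \<le> r" "r \<le> n" for r
    using that
  proof (induction r rule: dec_induct)
    case base
    then show ?case using validD(1)[OF V] by simp
  next
    case (step r)
    then show ?case using highest_weight_excess[OF assms(1,2), of r r]
      by (simp add: lessThan_Suc_atMost)
  qed
  from this[of r] show ?thesis
    using assms(3) validD(3)[OF V, of r x] by (cases "r \<le> n") auto
qed

lemma highest_weight_diagonal:
  assumes "P \<in> PTab n" "highest_weight n P" "word_cond (entries P)"
  shows "diagonal (entries P)"
  unfolding diagonal_def
  using highest_weight_lower[OF assms(1,2)] word_cond_upper[OF PTab_entries(1)[OF assms(1)] assms(3)]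
  by (metis linorder_neqE_nat)

text \<open>Nonpositive excess at \<open>Suc x\<close> makes the diagonal counts weakly decreasing,
  and for a diagonal matrix this is all the word condition asks.\<close>

lemma diagonal_word_cond:
  assumes P: "P \<in> PTab n" "highest_weight n P" and D: "diagonal (entries P)"
  shows "word_cond (entries P)"
  unfolding word_cond_def
proof (intro allI impI)
  fix x r :: nat assume x: "1 \<le> x"
  have D0: "entries P y s = 0" if "y \<noteq> s" for y s using D that by (auto simp: diagonal_def)
  have "entries P (Suc x) (Suc x) \<le> entries P x x"
  proof (cases "x < n")
    case True
    have "(\<Sum>y\<le>Suc x. entries P y (x + 1)) = entries P (Suc x) (Suc x)"
      by (simp add: D0)
    moreover have "(\<Sum>y<Suc x. entries P y x) = entries P x x" by (simp add: D0)
    ultimately show ?thesis using highest_weight_excess[OF P x True, of "Suc x"] by simp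
  next
    case False
    then show ?thesis using validD(3)[OF PTab_entries(1)[OF P(1)]] by simp
  qed
  then show "sum (entries P (Suc x)) {..Suc r} \<le> sum (entries P x) {..r}"
    by (simp only: diagonal_sum[OF D]) simp
qed

text \<open>The total of each entry is its diagonal count. As totals are constant on components, a
  component contains at most one diagonal element.\<close>

lemma diagonal_unique:
  assumes "P \<in> PTab n" "Q \<in> PTab n" "diagonal (entries P)" "diagonal (entries Q)"
    and "\<And>y. sum (entries P y) {..n} = sum (entries Q y) {..n}"
  shows "P = Q"
proof -
  have "entries P x r = entries Q x r" for x r
  proof (cases "x = r \<and> r \<le> n")
    case True
    then show ?thesis using assms(5)[of x] diagonal_sum[OF assms(3)] diagonal_sum[OF assms(4)] by simp
  next
    case False
    then show ?thesis using assms(3,4) validD(3) PTab_entries(1)[OF assms(1)]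
        PTab_entries(1)[OF assms(2)] unfolding diagonal_def by (metis not_less)
  qed
  then have "entries P = entries Q" by blast
  then show ?thesis using PTab_entries(2) assms(1,2) by metis
qed

lemma distinguished_word_cond:
  assumes P: "P \<in> PTab n" and D: "in_distinguished n P"
  shows "word_cond (entries P)"
proof -
  obtain H where H: "H \<in> irr_crystal n P" "highest_weight n H" "diagonal (entries H)"
    using D unfolding in_distinguished_def diagonal_def by blast
  then show ?thesis
    using diagonal_word_cond[OF irr_crystal_PTab[OF P]] irr_crystal_invariant(1) by blast
qed

section \<open>Action of the operators on the distinguished crystal\<close>

text \<open>The hypotheses make \<open>z\<close> the selected entry. Up to \<open>z\<close> nothing
  is subtracted, so the excess rises to its value at \<open>z\<close>; from there to
  \<open>k\<close> nothing is added; past \<open>k\<close> the gain \<open>M (k + 1) (k + 1)\<close>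
  is outweighed by \<open>M k k\<close>.\<close>

lemma cr_e_eq:
  assumes M: "valid_matrix n M" and k: "1 \<le> k" and z: "z \<le> k" "M z (k + 1) \<noteq> 0"
    and below: "\<And>x. x < z \<Longrightarrow> M x k = 0" and gap: "\<And>x. z < x \<Longrightarrow> x \<le> k \<Longrightarrow> M x (k + 1) = 0"
    and above: "\<And>x. k + 1 < x \<Longrightarrow> M x (k + 1) = 0" and last: "M (k + 1) (k + 1) \<le> M k k"
  shows "cr_e n k (ptab_of n M) = Some (ptab_of n (move_up k z M))"
proof -
  let ?a = "\<lambda>x. M x k" and ?b = "\<lambda>x. M x (k + 1)"
  have z0: "0 < z" using z(2) validD(1)[OF M] by (cases z) auto
  have a0: "sum ?a {..<u} = 0" if "u \<le> z" for u using that below by simp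
  have mem: "excess ?a ?b z = int (sum ?b {..z})" by (simp add: excess_def a0)
  have "excess ?a ?b u < excess ?a ?b z" if "u < z" for u
  proof -
    have "sum ?b {..u} \<le> sum ?b {..<z}" by (rule sum_le_lessThan[OF that])
    also have "\<dots> < sum ?b {..z}" using z(2) by (simp flip: lessThan_Suc_atMost)
    finally show ?thesis unfolding excess_def using a0[of u] a0[of z] that by linarith
  qed
  moreover have "excess ?a ?b u \<le> excess ?a ?b z" if "z < u" for u
  proof (cases "u \<le> k")
    case True
    have "sum ?b {..u} = sum ?b {..z}"
      by (rule sum.mono_neutral_right) (use True that gap in auto)
    then show ?thesis unfolding excess_def using a0[of z] by linarith
  next
    case False
    have "sum ?b {..u} = sum ?b (insert (k + 1) {..z})"
    proof (rule sum.mono_neutral_right)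
      have "?b x = 0" if "x \<noteq> k + 1" "z < x" for x
        using that gap[of x] above[of x] by (cases "x \<le> k") auto
      then show "\<forall>x\<in>{..u} - insert (k + 1) {..z}. ?b x = 0" by auto
    qed (use False that in auto)
    also have "\<dots> = sum ?b {..z} + ?b (k + 1)" using z by simp
    finally have "sum ?b {..u} = sum ?b {..z} + ?b (k + 1)" .
    moreover have "?a k \<le> sum ?a {..<u}" by (rule member_le_sum) (use False in auto)
    ultimately show ?thesis unfolding excess_def using last a0[of z] by linarith
  qed
  ultimately have selected: "selected ?a ?b z" using z0 by (simp add: selected_def)
  have "0 < sum ?b {..z}" using z(2) by (simp flip: lessThan_Suc_atMost)
  then have "\<not> excess ?a ?b z \<le> 0" unfolding mem by linarith
  then show ?thesis using cr_e_ptab_of[OF M k] selected_unique[OF selected] by auto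
qed

definition move_up_all :: "nat \<Rightarrow> (nat \<Rightarrow> nat \<Rightarrow> nat) \<Rightarrow> nat \<Rightarrow> nat \<Rightarrow> nat" where
  "move_up_all k M x r = (if x \<le> k \<and> r = k then M x k + M x (k + 1)
     else if x \<le> k \<and> r = k + 1 then 0 else M x r)"

lemma e_op_power:
  assumes "valid_matrix n M" "1 \<le> k"
    and "\<And>x y. M x k \<noteq> 0 \<Longrightarrow> M y (k + 1) \<noteq> 0 \<Longrightarrow> y \<le> k \<Longrightarrow> y \<le> x"
    and "\<And>x. k + 1 < x \<Longrightarrow> M x (k + 1) = 0" and "M (k + 1) (k + 1) \<le> M k k"
  shows "(e_op n k ^^ (\<Sum>x\<le>k. M x (k + 1))) (Some (ptab_of n M)) = Some (ptab_of n (move_up_all k M))"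
  using assms
proof (induction "\<Sum>x\<le>k. M x (k + 1)" arbitrary: M)
  case 0
  then have "M x (k + 1) = 0" if "x \<le> k" for x using that by simp
  then have "move_up_all k M = M" by (auto simp: move_up_all_def fun_eq_iff)
  then show ?case using 0 by simp
next
  case (Suc t)
  define z where "z = (GREATEST z. z \<le> k \<and> M z (k + 1) \<noteq> 0)"
  have "\<exists>z. z \<le> k \<and> M z (k + 1) \<noteq> 0"
  proof (rule ccontr)
    assume "\<not> ?thesis"
    then show False using Suc(2) by simp
  qed
  then have z: "z \<le> k \<and> M z (k + 1) \<noteq> 0"
    unfolding z_def by (rule GreatestI_ex_nat) blast
  have zmax: "y \<le> z" if "y \<le> k" "M y (k + 1) \<noteq> 0" for y
    unfolding z_def by (rule Greatest_le_nat) (use that in blast)+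
  let ?M = "move_up k z M"
  have e: "cr_e n k (ptab_of n M) = Some (ptab_of n ?M)"
    proof (rule cr_e_eq)
    show "M x (k + 1) = 0" if "z < x" "x \<le> k" for x using zmax[of x] that by (meson not_less)
    show "M x k = 0" if "x < z" for x using Suc.prems(3)[of x z] z that by (meson not_less)
  qed (use Suc.prems z in auto)
  have "(\<Sum>x\<le>k. M x (k + 1)) = Suc (\<Sum>x\<le>k. ?M x (k + 1))"
    using z by (simp add: sum.remove[of _ z] move_up_def)
  then have t: "t = (\<Sum>x\<le>k. ?M x (k + 1))" using Suc(2) by simp
  have "(e_op n k ^^ (\<Sum>x\<le>k. ?M x (k + 1))) (Some (ptab_of n ?M)) = Some (ptab_of n (move_up_all k ?M))"
  proof (rule Suc(1)[of ?M, OF t])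
    show "valid_matrix n ?M" by (rule valid_move_up) (use Suc.prems z in auto)
  qed (use Suc.prems z zmax in \<open>auto simp: move_up_def split: if_splits\<close>)
  moreover have "move_up_all k ?M = move_up_all k M"
    using z by (auto simp: move_up_all_def move_up_def fun_eq_iff)
  ultimately show ?case
    unfolding Suc(2)[symmetric] t[symmetric] funpow_Suc_right by (simp add: e_op_def e)
qed

text \<open>The state reached from \<open>\<alpha>\<close> after \<open>l\<close> full levels and the first \<open>k\<close> powers of level \<open>l + 1\<close>.\<close>

definition partial_lift :: "(nat \<Rightarrow> nat \<Rightarrow> nat) \<Rightarrow> nat \<Rightarrow> nat \<Rightarrow> nat \<Rightarrow> nat \<Rightarrow> nat" where
  "partial_lift \<alpha> l k x r =
     (if r < x then 0
      else if r = x then \<Sum>j=x..x + (if r \<le> k then Suc l else l). \<alpha> x j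
      else if r \<le> k then \<alpha> x (Suc (r + l))
      else if r = Suc k then 0
      else \<alpha> x (r + l))"

text \<open>Cells only move up and never above the diagonal: a nonzero count at \<open>x\<close> and
  \<open>r\<close> comes from some \<open>\<alpha> x j\<close> with \<open>r \<le> j\<close>, and
  \<open>x \<le> r\<close>.\<close>

lemma valid_partial_lift:
  assumes "valid_matrix n \<alpha>"
  shows "valid_matrix n (partial_lift \<alpha> l k)"
proof -
  obtain X where X: "\<And>y r. \<alpha> y r \<noteq> 0 \<Longrightarrow> 1 \<le> y \<and> y \<le> X \<and> 1 \<le> r \<and> r \<le> n"
    using assms unfolding valid_matrix_def by blast
  have "1 \<le> x \<and> x \<le> X \<and> 1 \<le> r \<and> r \<le> n" if nz: "partial_lift \<alpha> l k x r \<noteq> 0" for x r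
  proof -
    have xr: "x \<le> r" using nz by (auto simp: partial_lift_def split: if_splits)
    have "\<exists>j\<ge>r. \<alpha> x j \<noteq> 0"
    proof (rule ccontr)
      assume "\<not> ?thesis"
      then have "\<And>j. r \<le> j \<Longrightarrow> \<alpha> x j = 0" by blast
      then show False using nz by (auto simp: partial_lift_def split: if_splits)
    qed
    then show ?thesis using X xr by fastforce
  qed
  then show ?thesis unfolding valid_matrix_def by blast
qed

text \<open>The off-diagonal cells now in the row below row \<open>Suc k\<close> are those that
  started in row \<open>Suc k + Suc l\<close>, so \<beta> counts them. Row \<open>Suc k\<close>
  itself holds only diagonal entries, so the moves are not obstructed.\<close>

lemma e_op_partial_lift:
  assumes V: "valid_matrix n \<alpha>" and W: "word_cond \<alpha>"
  shows "(e_op n (Suc k) ^^ \<beta> \<alpha> (Suc k) (Suc k + Suc l)) (Some (ptab_of n (partial_lift \<alpha> l k))) =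
    Some (ptab_of n (partial_lift \<alpha> l (Suc k)))"
proof -
  let ?M = "partial_lift \<alpha> l k" and ?k = "Suc k"
  have lift: "move_up_all ?k ?M = partial_lift \<alpha> l ?k"
    by (auto simp: move_up_all_def partial_lift_def fun_eq_iff)
  have "(\<Sum>x\<le>?k. ?M x (?k + 1)) = (\<Sum>x\<le>?k. \<alpha> x (?k + Suc l))"
    by (rule sum.cong) (auto simp: partial_lift_def)
  also have "\<dots> = \<beta> \<alpha> ?k (?k + Suc l)"
    unfolding \<beta>_def by (rule sum.mono_neutral_right) (use validD(1)[OF V] in \<open>auto simp: not_le\<close>)
  finally have t: "(\<Sum>x\<le>?k. ?M x (?k + 1)) = \<beta> \<alpha> ?k (?k + Suc l)" .
  \<comment> \<open>No \<open>x\<close> lies above row \<open>x\<close>, so diagonal counts are full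
    prefix sums and the word condition compares neighbouring ones.\<close>
  have S: "(\<Sum>j=x..r. \<alpha> x j) = sum (\<alpha> x) {..r}" for x r
    by (rule sum.mono_neutral_left) (use word_cond_upper[OF V W] in auto)
  have "(\<Sum>j=Suc ?k..Suc (?k + l). \<alpha> (Suc ?k) j) \<le> (\<Sum>j=?k..?k + l. \<alpha> ?k j)"
    unfolding S
    using W unfolding word_cond_def by (simp del: sum.atMost_Suc)
  then have last: "?M (?k + 1) (?k + 1) \<le> ?M ?k ?k" by (simp add: partial_lift_def)
  have "(e_op n ?k ^^ (\<Sum>x\<le>?k. ?M x (?k + 1))) (Some (ptab_of n ?M)) = Some (ptab_of n (move_up_all ?k ?M))"
  proof (rule e_op_power)
    show "valid_matrix n ?M" by (rule valid_partial_lift[OF V])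
    show "?M (?k + 1) (?k + 1) \<le> ?M ?k ?k" by (rule last)
  qed (auto simp: partial_lift_def split: if_splits)
  then show ?thesis unfolding t lift .
qed

lemma e_level_partial_lift:
  assumes V: "valid_matrix n \<alpha>" and W: "word_cond \<alpha>" and l: "l < n"
  shows "e_level n \<alpha> (Suc l) (Some (ptab_of n (partial_lift \<alpha> l 0))) =
    Some (ptab_of n (partial_lift \<alpha> (Suc l) 0))"
proof -
  have "fold (\<lambda>k. e_op n k ^^ \<beta> \<alpha> k (k + Suc l)) [1..<m + 1] (Some (ptab_of n (partial_lift \<alpha> l 0))) =
    Some (ptab_of n (partial_lift \<alpha> l m))" for m
    using e_op_partial_lift[OF V W] by (induction m) simp_all
  \<comment> \<open>The rows after \<open>n - Suc l\<close> would be refilled from rows of \<alpha>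
    beyond \<open>n\<close>, which are empty, so the level is complete.\<close>
  moreover have "partial_lift \<alpha> l (n - Suc l) = partial_lift \<alpha> (Suc l) 0"
  proof (intro ext)
    fix x r
    have Z: "\<alpha> x s = 0" if "n < s" for s using validD(3)[OF V that] .
    have Z0: "\<alpha> 0 s = 0" for s using validD(1)[OF V] .
    show "partial_lift \<alpha> l (n - Suc l) x r = partial_lift \<alpha> (Suc l) 0 x r"
      using l by (cases "x = 0") (auto simp: partial_lift_def Z Z0)
  qed
  ultimately show ?thesis unfolding e_level_def by simp
qed

lemma e_star_diagonal:
  assumes V: "valid_matrix n \<alpha>" and W: "word_cond \<alpha>"
  obtains N where "e_star n \<alpha> (Some (ptab_of n \<alpha>)) = Some (ptab_of n N)" "valid_matrix n N" "diagonal N"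
proof
  have Z0: "\<alpha> 0 s = 0" for s using validD(1)[OF V] .
  have start: "partial_lift \<alpha> 0 0 = \<alpha>"
    using word_cond_upper[OF V W] Z0 by (auto simp: partial_lift_def fun_eq_iff)
  have "fold (e_level n \<alpha>) [1..<m + 1] (Some (ptab_of n \<alpha>)) = Some (ptab_of n (partial_lift \<alpha> m 0))"
    if "m \<le> n - 1" for m
    using that by (induction m) (simp_all add: start e_level_partial_lift[OF V W])
  from this[of "n - 1"] show "e_star n \<alpha> (Some (ptab_of n \<alpha>)) = Some (ptab_of n (partial_lift \<alpha> (n - 1) 0))"
    unfolding e_star_def by (cases n) simp_all
  show "valid_matrix n (partial_lift \<alpha> (n - 1) 0)" by (rule valid_partial_lift[OF V])
  \<comment> \<open>An off-diagonal row has index at least 1. Row 1 has been emptied of such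
    entries, and every later one draws on a row of \<alpha> beyond \<open>n\<close>.\<close>
  show "diagonal (partial_lift \<alpha> (n - 1) 0)"
    using validD(3)[OF V] Z0 by (auto simp: diagonal_def partial_lift_def split: if_splits)
qed

section \<open>Transport along the crystal isomorphism\<close>

text \<open>Stability of \<open>X\<close> is included so that composites stay where \<phi> commutes
  with the operators; options let the null element pass through.\<close>

definition equivariant :: "ptab set \<Rightarrow> (ptab \<Rightarrow> ptab) \<Rightarrow> (ptab option \<Rightarrow> ptab option) \<Rightarrow> bool" where
  "equivariant X \<phi> f \<longleftrightarrow> (\<forall>p. set_option p \<subseteq> X \<longrightarrow>
     set_option (f p) \<subseteq> X \<and> f (map_option \<phi> p) = map_option \<phi> (f p))"

lemma equivariant_funpow: "equivariant X \<phi> f \<Longrightarrow> equivariant X \<phi> (f ^^ m)"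
  by (induction m) (auto simp: equivariant_def)

lemma equivariant_fold:
  "(\<And>k. k \<in> set ks \<Longrightarrow> equivariant X \<phi> (f k)) \<Longrightarrow> equivariant X \<phi> (fold f ks)"
  by (induction ks) (auto simp: equivariant_def)

lemma equivariant_e_star:
  assumes T: "T \<in> PTab n" and iso: "crystal_iso n (irr_crystal n T) Y \<phi>"
  shows "equivariant (irr_crystal n T) \<phi> (e_star n \<alpha>)"
proof -
  let ?X = "irr_crystal n T"
  have "equivariant ?X \<phi> (e_op n k)" if k: "k \<in> {1..<n}" for k
    unfolding equivariant_def
  proof (intro allI impI)
    fix p assume p: "set_option p \<subseteq> ?X"
    show "set_option (e_op n k p) \<subseteq> ?X \<and> e_op n k (map_option \<phi> p) = map_option \<phi> (e_op n k p)"
    proof (cases p)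
      case (Some P)
      then have "P \<in> ?X" using p by simp
      then show ?thesis using Some irr_crystal_cr_e[OF T _ k] iso k
        by (cases "cr_e n k P") (auto simp: e_op_def crystal_iso_def)
    qed (simp add: e_op_def)
  qed
  \<comment> \<open>With \<open>1 \<le> l\<close> every index used at the level is at most
    \<open>n - l\<close>, hence below \<open>n\<close>.\<close>
  then have "equivariant ?X \<phi> (e_level n \<alpha> l)" if "1 \<le> l" for l
    unfolding e_level_def using that by (intro equivariant_fold equivariant_funpow) auto
  then show ?thesis unfolding e_star_def by (intro equivariant_fold) auto
qed

theorem theorem4p4:
  fixes n :: nat and T PT Tmax :: ptab and \<alpha> :: "nat \<Rightarrow> nat \<Rightarrow> nat"
  assumes "T \<in> PTab n"
    and "RSK n T (PT, Tmax)"
    and "\<And>i j. \<alpha> i j = entries PT i j"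
  shows "e_star n \<alpha> (Some T) = Some Tmax"
proof -
  let ?X = "irr_crystal n T" and ?Y = "irr_crystal n PT"
  have PT: "PT \<in> PTab n" and D: "in_distinguished n PT"
    and Tmax: "Tmax \<in> ?X" "highest_weight n Tmax" and pl: "plactic_equiv n T PT"
    using assms(2) by (simp_all add: RSK_def)
  obtain \<phi> where iso: "crystal_iso n ?X ?Y \<phi>" and \<phi>T: "\<phi> T = PT"
    using pl unfolding plactic_equiv_def by blast
  have \<alpha>: "\<alpha> = entries PT" using assms(3) by blast
  note V = PTab_entries[OF PT] and W = distinguished_word_cond[OF PT D]
  obtain N where N: "e_star n \<alpha> (Some PT) = Some (ptab_of n N)" "valid_matrix n N" "diagonal N"
    using e_star_diagonal[OF V(1) W] unfolding V(2) \<alpha> by blast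
  have TX: "T \<in> ?X" by (simp add: irr_crystal_def)
  then have "set_option (e_star n \<alpha> (Some T)) \<subseteq> ?X"
    "e_star n \<alpha> (Some PT) = map_option \<phi> (e_star n \<alpha> (Some T))"
    using equivariant_e_star[OF assms(1) iso, of \<alpha>] \<phi>T
    by (auto simp: equivariant_def dest: spec[of _ "Some T"])
  \<comment> \<open>The null element cannot arise from \<open>T\<close>, since its image under
    \<phi> would be null while the result on \<open>PT\<close> is not.\<close>
  then obtain Q where Q: "e_star n \<alpha> (Some T) = Some Q" "Q \<in> ?X" "\<phi> Q = ptab_of n N"
    using N(1) by (cases "e_star n \<alpha> (Some T)") auto
  have bij: "bij_betw \<phi> ?X ?Y" using iso by (simp add: crystal_iso_def)
  then have Y: "\<phi> Q \<in> ?Y" "\<phi> Tmax \<in> ?Y" using Q(2) Tmax(1) bij_betwE by blast+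
  have "highest_weight n (\<phi> Tmax)"
    using iso Tmax by (simp add: highest_weight_def crystal_iso_def)
  then have "diagonal (entries (\<phi> Tmax))"
    using highest_weight_diagonal irr_crystal_PTab[OF PT Y(2)] irr_crystal_invariant(1)[OF Y(2)] W
    by blast
  moreover have "diagonal (entries (\<phi> Q))" using N Q(3) by (simp add: entries_ptab_of)
  \<comment> \<open>Both are diagonal and lie in the component of \<open>PT\<close>, so their entry
    totals agree.\<close>
  ultimately have "\<phi> Q = \<phi> Tmax"
    using irr_crystal_PTab[OF PT] Y irr_crystal_invariant(2)
    by (intro diagonal_unique[of _ n]) auto
  then have "Q = Tmax" using bij Q(2) Tmax(1) by (auto simp: bij_betw_def inj_on_def)
  then show ?thesis using Q(1) by simp
qed

end
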